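(* Fix $m \in \mathbb{N}$, $n \in \mathbb{N}$ with $n \ge 3$, and $N' \in \mathbb{N}$. Then for all sufficiently large $N \in \mathbb{N}$ (i.e. there exists $N_0 = N_0(m,n,N')$ such that for all $N \ge N_0$), the estimator $\tilde{\boldsymbol p}$ is dominated by the estimator $\hat{\boldsymbol p}$ under the entropy loss $L$.
   Context: Here $\mathbb{N} = \{1,2,\dots\}$. Parameter space: $\Theta = \{ ((p_{i,j})_{j=0}^{n})_{i=0}^{m} \in (0,\infty)^{(1+m)(1+n)} : \sum_{i=0}^{m}\sum_{j=0}^{n} p_{i,j} = 1 \}$; the unknown parameter is $\boldsymbol p = ((p_{i,j})_{j=0}^{n})_{i=0}^{m} \in \Theta$. Observations: $\boldsymbol X = ((X_{i,j})_{j=0}^{n})_{i=0}^{m}$ is multinomial with $N$ trials and cell probabilities $\boldsymbol p$. Independently of $\boldsymbol X$, $\boldsymbol Y^* = ((Y^*_{i,j})_{j=0}^{n})_{i=0}^{m}$ is multinomial with $N'$ trials and cell probabilities $\boldsymbol p$, and only the row totals $\boldsymbol Y = (Y_i)_{i=0}^{m}$, $Y_i = \sum_{j=0}^{n} Y^*_{i,j}$, are observed (so $\boldsymbol Y$ is multinomial with $N'$ trials and cell probabilities $(\sum_{j=0}^{n} p_{i,j})_{i=0}^{m}$). Write $X_{i,\cdot} = \sum_{j=0}^{n} X_{i,j}$. Entropy loss: $L(\boldsymbol d, \boldsymbol p) = \sum_{i=0}^{m}\sum_{j=0}^{n} p_{i,j} \log (p_{i,j}/d_{i,j})$ for $\boldsymbol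 d, \boldsymbol p \in \Theta$. Estimators (the Bayes estimators under the Jeffreys prior based on $\boldsymbol X$ and on $(\boldsymbol X, \boldsymbol Y)$, respectively): $$\tilde p_{i,j} = \frac{X_{i,j} + 1/2}{N + (1+m)(1+n)/2}, \qquad \hat p_{i,j} = \frac{X_{i,\cdot} + Y_i + (1+n)/2}{N + N' + (1+m)(1+n)/2}\cdot\frac{X_{i,j}+1/2}{X_{i,\cdot} + (1+n)/2},$$ with $\tilde{\boldsymbol p} = ((\tilde p_{i,j})_{j=0}^{n})_{i=0}^{m}$ and $\hat{\boldsymbol p} = ((\hat p_{i,j})_{j=0}^{n})_{i=0}^{m}$. Dominance: $\tilde{\boldsymbol p}$ is dominated by $\hat{\boldsymbol p}$ if $E_{\boldsymbol p}[L(\hat{\boldsymbol p}, \boldsymbol p)] \le E_{\boldsymbol p}[L(\tilde{\boldsymbol p}, \boldsymbol p)]$ for all $\boldsymbol p \in \Theta$, with strict inequality for at least one $\boldsymbol p \in \Theta$, where $E_{\boldsymbol p}$ is expectation over the joint law of $(\boldsymbol X, \boldsymbol Y)$ under $\boldsymbol p$. *)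

theory Defs
  imports "HOL-Probability.Probability"
begin

section \<open>Multinomial distributions\<close>

text \<open>
  Count vectors over a finite index set \<open>A\<close> are functions that vanish outside \<open>A\<close>.
\<close>

definition count_vectors :: "'a set \<Rightarrow> nat \<Rightarrow> ('a \<Rightarrow> nat) set" where
  "count_vectors A N = {x. (\<forall>a. a \<notin> A \<longrightarrow> x a = 0) \<and> (\<Sum>a\<in>A. x a) = N}"

definition multinomial_mass :: "'a set \<Rightarrow> nat \<Rightarrow> ('a \<Rightarrow> real) \<Rightarrow> ('a \<Rightarrow> nat) \<Rightarrow> real" where
  "multinomial_mass A N p x =
     (if x \<in> count_vectors A N
      then fact N / (\<Prod>a\<in>A. fact (x a)) * (\<Prod>a\<in>A. p a ^ x a) else 0)"

text \<open>
  \<^const>\<open>embed_pmf\<close> is meaningful only for a genuine mass function; lemma \<open>pmf_multinomial\<close>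
  below shows that this is the case whenever \<open>p\<close> is a probability vector on the finite set \<open>A\<close>.
\<close>

definition multinomial_pmf :: "'a set \<Rightarrow> nat \<Rightarrow> ('a \<Rightarrow> real) \<Rightarrow> ('a \<Rightarrow> nat) pmf" where
  "multinomial_pmf A N p = embed_pmf (multinomial_mass A N p)"

lemma count_vectors_insert:
  assumes "finite A" "a \<notin> A"
  shows "bij_betw (\<lambda>(k, x). x(a := k)) (SIGMA k:{..N}. count_vectors A (N - k))
           (count_vectors (insert a A) N)"
proof (rule bij_betwI[where g = "\<lambda>x. (x a, x(a := 0))"])
  have s: "(\<Sum>b\<in>A. (x(a := k)) b) = (\<Sum>b\<in>A. x b)" for x :: "'a \<Rightarrow> nat" and k
    using assms by (intro sum.cong) auto
  show "(\<lambda>(k, x). x(a := k)) \<in> (SIGMA k:{..N}. count_vectors A (N - k))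
          \<rightarrow> count_vectors (insert a A) N"
    using assms by (auto simp: count_vectors_def s simp del: fun_upd_apply) auto
  show "(\<lambda>x. (x a, x(a := 0))) \<in> count_vectors (insert a A) N
          \<rightarrow> (SIGMA k:{..N}. count_vectors A (N - k))"
    using assms by (auto simp: count_vectors_def s simp del: fun_upd_apply) auto
qed (use assms in \<open>auto simp: count_vectors_def fun_upd_idem\<close>)

lemma finite_count_vectors: "finite A \<Longrightarrow> finite (count_vectors A N)"
proof (induction A arbitrary: N rule: finite_induct)
  case empty
  have "count_vectors {} N \<subseteq> {\<lambda>_. 0 :: nat}" by (auto simp: count_vectors_def)
  then show ?case by (rule finite_subset) simp
next
  case (insert a A)
  then show ?case
    using bij_betw_finite[OF count_vectors_insert[of A a N]] by auto
qed

lemma multinomial_theorem: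
  fixes p :: "'a \<Rightarrow> real"
  assumes "finite A"
  shows "(\<Sum>x\<in>count_vectors A N. fact N / (\<Prod>a\<in>A. fact (x a)) * (\<Prod>a\<in>A. p a ^ x a))
           = (\<Sum>a\<in>A. p a) ^ N"
  using assms
proof (induction A arbitrary: N rule: finite_induct)
  case empty
  have "count_vectors {} N = (if N = 0 then {\<lambda>_::'a. 0 :: nat} else {})"
    by (auto simp: count_vectors_def)
  then show ?case by auto
next
  case (insert a A)
  let ?f = "\<lambda>B M x. fact M / (\<Prod>a\<in>B. fact (x a)) * (\<Prod>a\<in>B. p a ^ x a) :: real"
  have e: "?f (insert a A) N (x(a := k)) = real (N choose k) * p a ^ k * ?f A (N - k) x"
    if "k \<le> N" for k x
  proof -
    have "(\<Prod>b\<in>A. fact ((x(a := k)) b)) = (\<Prod>b\<in>A. fact (x b) :: real)"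
      "(\<Prod>b\<in>A. p b ^ ((x(a := k)) b)) = (\<Prod>b\<in>A. p b ^ x b)"
      using insert.hyps by (auto intro!: prod.cong)
    then show ?thesis
      using insert.hyps that by (simp add: binomial_fact field_simps del: fun_upd_apply) simp
  qed
  have "(\<Sum>x\<in>count_vectors (insert a A) N. ?f (insert a A) N x)
      = (\<Sum>(k, x)\<in>(SIGMA k:{..N}. count_vectors A (N - k)). ?f (insert a A) N (x(a := k)))"
    by (subst sum.reindex_bij_betw[OF count_vectors_insert[OF insert.hyps], symmetric])
      (simp add: case_prod_unfold del: fun_upd_apply)
  also have "\<dots> = (\<Sum>k\<le>N. \<Sum>x\<in>count_vectors A (N - k). ?f (insert a A) N (x(a := k)))"
    using insert.hyps by (subst sum.Sigma) (auto intro: finite_count_vectors)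
  also have "\<dots> = (\<Sum>k\<le>N. \<Sum>x\<in>count_vectors A (N - k).
      real (N choose k) * p a ^ k * ?f A (N - k) x)"
    by (intro sum.cong refl e) auto
  also have "\<dots> = (\<Sum>k\<le>N. real (N choose k) * p a ^ k * (\<Sum>a\<in>A. p a) ^ (N - k))"
    by (simp only: sum_distrib_left[symmetric] insert.IH)
  also have "\<dots> = (p a + (\<Sum>a\<in>A. p a)) ^ N"
    by (simp add: binomial_ring)
  finally show ?case using insert.hyps by simp
qed

lemma pmf_multinomial:
  assumes "finite A" "\<And>a. a \<in> A \<Longrightarrow> 0 \<le> p a" "(\<Sum>a\<in>A. p a) = 1"
  shows "pmf (multinomial_pmf A N p) x = multinomial_mass A N p x"
  unfolding multinomial_pmf_def
proof (rule pmf_embed_pmf)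
  show nn: "0 \<le> multinomial_mass A N p x" for x
    using assms by (auto simp: multinomial_mass_def
        intro!: mult_nonneg_nonneg divide_nonneg_nonneg prod_nonneg)
  have "(\<integral>\<^sup>+x. ennreal (multinomial_mass A N p x) \<partial>count_space UNIV)
      = (\<Sum>x\<in>count_vectors A N. ennreal (multinomial_mass A N p x))"
    using finite_count_vectors[OF assms(1)]
    by (intro nn_integral_count_space') (auto simp: multinomial_mass_def)
  also have "\<dots> = ennreal (\<Sum>x\<in>count_vectors A N. multinomial_mass A N p x)"
    using nn by (simp add: sum_ennreal)
  also have "(\<Sum>x\<in>count_vectors A N. multinomial_mass A N p x) = 1"
    using multinomial_theorem[OF assms(1), of N p] assms(3) by (simp add: multinomial_mass_def)
  finally show "(\<integral>\<^sup>+x. ennreal (multinomial_mass A N p x) \<partial>count_space UNIV) = 1"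
    by simp
qed

section \<open>The statistical model\<close>

definition cells :: "nat \<Rightarrow> nat \<Rightarrow> (nat \<times> nat) set" where
  "cells m n = {0..m} \<times> {0..n}"

text \<open>
  Arrays are functions of the pair \<open>(i, j)\<close>. The values of a parameter outside \<open>cells m n\<close>
  are left unconstrained; no definition below depends on them.
\<close>

definition Theta :: "nat \<Rightarrow> nat \<Rightarrow> (nat \<times> nat \<Rightarrow> real) set" where
  "Theta m n = {p. (\<forall>i\<in>{0..m}. \<forall>j\<in>{0..n}. 0 < p (i, j)) \<and> (\<Sum>i=0..m. \<Sum>j=0..n. p (i, j)) = 1}"

definition row_totals :: "nat \<Rightarrow> nat \<Rightarrow> (nat \<times> nat \<Rightarrow> nat) \<Rightarrow> nat \<Rightarrow> nat" where
  "row_totals m n z i = (if i \<le> m then \<Sum>j=0..n. z (i, j) else 0)"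

text \<open>The joint law of \<open>(X, Y)\<close>; the product makes \<open>X\<close> and \<open>Y\<^sup>*\<close> independent.\<close>

definition observation_pmf ::
  "nat \<Rightarrow> nat \<Rightarrow> nat \<Rightarrow> nat \<Rightarrow> (nat \<times> nat \<Rightarrow> real) \<Rightarrow> ((nat \<times> nat \<Rightarrow> nat) \<times> (nat \<Rightarrow> nat)) pmf" where
  "observation_pmf m n N N' p =
     pair_pmf (multinomial_pmf (cells m n) N p)
              (map_pmf (row_totals m n) (multinomial_pmf (cells m n) N' p))"

definition entropy_loss ::
  "nat \<Rightarrow> nat \<Rightarrow> (nat \<times> nat \<Rightarrow> real) \<Rightarrow> (nat \<times> nat \<Rightarrow> real) \<Rightarrow> real" where
  "entropy_loss m n d p = (\<Sum>i=0..m. \<Sum>j=0..n. p (i, j) * ln (p (i, j) / d (i, j)))"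

type_synonym estimator = "(nat \<times> nat \<Rightarrow> nat) \<Rightarrow> (nat \<Rightarrow> nat) \<Rightarrow> (nat \<times> nat \<Rightarrow> real)"

definition p_tilde :: "nat \<Rightarrow> nat \<Rightarrow> nat \<Rightarrow> estimator" where
  "p_tilde m n N X Y = (\<lambda>(i, j).
     (real (X (i, j)) + 1 / 2) / (real N + (1 + real m) * (1 + real n) / 2))"

definition p_hat :: "nat \<Rightarrow> nat \<Rightarrow> nat \<Rightarrow> nat \<Rightarrow> estimator" where
  "p_hat m n N N' X Y = (\<lambda>(i, j).
     (real (row_totals m n X i) + real (Y i) + (1 + real n) / 2)
       / (real N + real N' + (1 + real m) * (1 + real n) / 2)
     * ((real (X (i, j)) + 1 / 2) / (real (row_totals m n X i) + (1 + real n) / 2)))"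

text \<open>The expectation is a finite sum, since \<^const>\<open>observation_pmf\<close> has finite support.\<close>

definition risk ::
  "nat \<Rightarrow> nat \<Rightarrow> nat \<Rightarrow> nat \<Rightarrow> estimator \<Rightarrow> (nat \<times> nat \<Rightarrow> real) \<Rightarrow> real" where
  "risk m n N N' d p =
     measure_pmf.expectation (observation_pmf m n N N' p) (\<lambda>(X, Y). entropy_loss m n (d X Y) p)"

definition dominated_by :: "nat \<Rightarrow> nat \<Rightarrow> nat \<Rightarrow> nat \<Rightarrow> estimator \<Rightarrow> estimator \<Rightarrow> bool" where
  "dominated_by m n N N' d d' \<longleftrightarrow>
     (\<forall>p\<in>Theta m n. risk m n N N' d' p \<le> risk m n N N' d p) \<and>
     (\<exists>p\<in>Theta m n. risk m n N N' d' p < risk m n N N' d p)"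

end

theory Submission
  imports Defs "HOL-Real_Asymp.Real_Asymp"
begin

text \<open>
  The two losses differ only through the estimated row totals, so with \<open>q\<close> the vector of row
  probabilities and \<open>b = (1 + n) / 2\<close> the risk difference compares the Bayes estimators of \<open>q\<close>
  from \<open>N\<close> and from \<open>N + N'\<close> observations, and it suffices to treat one additional
  observation. There the risk decreases iff
  \<open>(\<Sum>i. q\<^sub>i\<^sup>2 * E (ln (1 + 1 / (Z\<^sub>i + b)))) > ln (1 + 1 / (N + (m + 1) * b))\<close> with \<open>Z\<close> multinomial
  with \<open>N\<close> trials. Size biasing twice absorbs \<open>q\<^sub>i\<^sup>2\<close>: up to the factor \<open>(N + 2) * (N + 1)\<close>, the left
  side is the expectation of \<open>\<Sum>i. Z\<^sub>i * (Z\<^sub>i - 1) * ln (1 + 1 / (Z\<^sub>i - 2 + b))\<close> under \<open>N + 2\<close> trials.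
  The parameter has disappeared from the integrand, and the inequality now holds pointwise for
  large \<open>N\<close>: \<open>ln (1 + 1 / y) \<ge> 1 / (y + 1 / 2)\<close> bounds the summands below by
  \<open>x * (x - 1) / (x + c)\<close> with \<open>c = b - 3 / 2\<close>, which is convex in \<open>x\<close> since \<open>n \<ge> 3\<close> makes \<open>c\<close>
  positive, so that equal \<open>Z\<^sub>i\<close> are the worst case.
\<close>

section \<open>Averaging over repeated draws\<close>

text \<open>
  The averaging operator of one multinomial draw. Its \<open>N\<close>-th iterate at the zero vector is the
  expectation under \<open>N\<close> trials (lemma \<open>expectation_multinomial\<close>).
\<close>

definition draw :: "'a set \<Rightarrow> ('a \<Rightarrow> real) \<Rightarrow> (('a \<Rightarrow> nat) \<Rightarrow> real) \<Rightarrow> ('a \<Rightarrow> nat) \<Rightarrow> real" where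
  "draw A p h x = (\<Sum>a\<in>A. p a * h (x(a := Suc (x a))))"

lemma funpow_draw_linear:
  "(draw A p ^^ n) (\<lambda>x. c * g x + h x) x = c * (draw A p ^^ n) g x + (draw A p ^^ n) h x"
proof (induction n arbitrary: g h)
  case (Suc n)
  have "draw A p (\<lambda>x. c * g x + h x) = (\<lambda>x. c * draw A p g x + draw A p h x)"
    by (simp add: draw_def fun_eq_iff algebra_simps sum.distrib sum_distrib_left)
  then show ?case by (simp add: funpow_Suc_right Suc del: funpow.simps)
qed simp

lemma funpow_draw_sum:
  "finite I \<Longrightarrow> (draw A p ^^ n) (\<lambda>x. \<Sum>i\<in>I. c i * g i x) x = (\<Sum>i\<in>I. c i * (draw A p ^^ n) (g i) x)"
proof (induction I rule: finite_induct)
  case empty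
  \<comment> \<open>For \<open>c = -1\<close> and zero functions, linearity writes the iterate of
    zero as minus itself plus itself, hence as zero.\<close>
  show ?case using funpow_draw_linear[of n A p "-1" "\<lambda>_. 0" "\<lambda>_. 0" x] by simp
qed (simp add: funpow_draw_linear)

lemma funpow_draw_const:
  assumes "(\<Sum>a\<in>A. p a) = 1"
  shows "(draw A p ^^ n) (\<lambda>_. c) x = c"
proof (induction n)
  case (Suc n)
  have "draw A p (\<lambda>_. c) = (\<lambda>_. c)"
    using assms by (simp add: draw_def fun_eq_iff flip: sum_distrib_right)
  with Suc show ?case by (simp add: funpow_Suc_right del: funpow.simps)
qed simp

text \<open>Each draw raises the total over \<open>A\<close> by one, so \<open>n\<close> draws from
  \<open>x\<close> only reach vectors of the total in the last hypothesis. A bound proved pointwise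
  at a fixed sample size thus passes to the expectation.\<close>

lemma funpow_draw_greater:
  assumes "finite A" "\<And>a. a \<in> A \<Longrightarrow> 0 \<le> p a" "(\<Sum>a\<in>A. p a) = 1"
    and "\<And>z. (\<Sum>a\<in>A. z a) = (\<Sum>a\<in>A. x a) + n \<Longrightarrow> c < h z"
  shows "c < (draw A p ^^ n) h x"
  using assms(4)
proof (induction n arbitrary: x)
  case (Suc n)
  have s: "(\<Sum>b\<in>A. (x(a := Suc (x a))) b) = Suc (\<Sum>b\<in>A. x b)" if "a \<in> A" for a
    using assms(1) that by (simp add: sum.remove[of A a])
  have gt: "c < (draw A p ^^ n) h (x(a := Suc (x a)))" if "a \<in> A" for a
    by (rule Suc.IH, rule Suc.prems) (simp only: s[OF that])
  \<comment> \<open>Strictness needs a cell of positive probability; one exists because the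
    probabilities sum to 1.\<close>
  obtain a where a: "a \<in> A" "0 < p a"
    using assms(2,3) by (metis less_eq_real_def sum.neutral zero_neq_one)
  have "(\<Sum>b\<in>A. p b * c) < (\<Sum>b\<in>A. p b * (draw A p ^^ n) h (x(b := Suc (x b))))"
    using a gt assms(2)
    by (intro sum_strict_mono_ex1[OF assms(1)] ballI bexI[of _ a])
      (auto simp: less_imp_le mult_left_mono simp del: fun_upd_apply)
  then show ?case
    using assms(3)
    by (simp add: draw_def[of A p "(draw A p ^^ n) h"] del: fun_upd_apply flip: sum_distrib_right)
qed simp

text \<open>A draw increments a count whatever its value, so averaging commutes with translation.
  This lets a second sample be read as a continuation of the first.\<close>

lemma funpow_draw_translate:
  "(draw A p ^^ n) (\<lambda>z. h (\<lambda>a. w a + z a)) x = (draw A p ^^ n) h (\<lambda>a. w a + x a)"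
proof (induction n arbitrary: x)
  case (Suc n)
  have "(\<lambda>b. w b + (x(a := Suc (x a))) b) = (\<lambda>b. w b + x b)(a := Suc (w a + x a))" for a
    by auto
  with Suc show ?case by (simp add: draw_def[of A p "(draw A p ^^ n) _"] del: fun_upd_apply)
qed simp

text \<open>The final \<open>z a\<close> is \<open>x a\<close> plus the number of draws that hit
  \<open>a\<close>; by exchangeability each of the \<open>Suc n\<close> draws contributes equally,
  and fixing one at \<open>a\<close> leaves \<open>n\<close> draws. The start is arbitrary because
  the induction moves it and because the identity is later applied from a nonzero start.\<close>

lemma funpow_draw_size_bias:
  assumes "finite A" "a \<in> A"
  shows "(draw A p ^^ Suc n) (\<lambda>z. real (z a) * h z) x =
    real (x a) * (draw A p ^^ Suc n) h x
      + real (Suc n) * p a * (draw A p ^^ n) h (x(a := Suc (x a)))"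
proof -
  have step: "(\<Sum>b\<in>A. p b * (real ((x(b := Suc (x b))) a) * g (x(b := Suc (x b)))))
      = real (x a) * draw A p g x + p a * g (x(a := Suc (x a)))" for g x
  proof -
    have "p b * (real ((x(b := Suc (x b))) a) * g (x(b := Suc (x b))))
        = real (x a) * (p b * g (x(b := Suc (x b))))
          + (if b = a then p a * g (x(a := Suc (x a))) else 0)" for b
      by (simp add: algebra_simps)
    then show ?thesis
      using assms by (simp add: draw_def sum.distrib sum_distrib_left del: fun_upd_apply)
  qed
  show ?thesis
  proof (induction n arbitrary: x)
    case 0
    show ?case using step[of x h] by (simp add: draw_def del: fun_upd_apply)
  next
    case (Suc n)
    have "(draw A p ^^ Suc (Suc n)) (\<lambda>z. real (z a) * h z) x
      = (\<Sum>b\<in>A. p b * (draw A p ^^ Suc n) (\<lambda>z. real (z a) * h z) (x(b := Suc (x b))))"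
      by (simp add: draw_def)
    also have "\<dots> = (\<Sum>b\<in>A. p b * (real ((x(b := Suc (x b))) a) * (draw A p ^^ Suc n) h (x(b := Suc (x b)))))
      + real (Suc n) * p a * (\<Sum>b\<in>A. p b * (draw A p ^^ n) h ((x(b := Suc (x b)))(a := Suc ((x(b := Suc (x b))) a))))"
      unfolding Suc by (simp only: distrib_left sum.distrib sum_distrib_left mult.left_commute mult.assoc)
    \<comment> \<open>The increments at \<open>b\<close> and at \<open>a\<close> commute, so this is
      one more draw from the vector already raised at \<open>a\<close>.\<close>
    also have "(\<Sum>b\<in>A. p b * (draw A p ^^ n) h ((x(b := Suc (x b)))(a := Suc ((x(b := Suc (x b))) a))))
      = (draw A p ^^ Suc n) h (x(a := Suc (x a)))"
      unfolding funpow.simps comp_def draw_def[of A p "(draw A p ^^ n) h"]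
      by (intro sum.cong refl arg_cong2[where f="(*)"] arg_cong[where f="(draw A p ^^ n) h"]) auto
    finally show ?case unfolding step by (simp add: algebra_simps del: fun_upd_apply)
  qed
qed

section \<open>Logarithmic and convexity bounds\<close>

text \<open>The right side is the sum of \<open>x * (x - 1) / (x + b - 3/2)\<close> over
  \<open>k\<close> rows with equal counts \<open>x = (N + 2) / k\<close>. Both sides grow like
  \<open>N\<close> with the same leading term, so the comparison is decided by the limit
  \<open>(k - 1) / 2\<close> of their difference.\<close>

lemma eventually_ln_less_balanced:
  fixes k b :: real
  assumes "1 < k"
  shows "eventually (\<lambda>N. real (N+2) * real (N+1) * ln (1 + 1 / (real N + k * b))
     < real (N+2) * (real (N+2) - k) / (real (N+2) + k * (b - 3/2))) sequentially"
proof -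
  have "((\<lambda>x::real. (x+2) * (x+2 - k) / (x+2 + k * (b - 3/2)) - (x+2) * (x+1) * ln (1 + 1 / (x + k * b)))
     \<longlongrightarrow> (k-1)/2) at_top"
    by (real_asymp simp: field_simps)
  then have "eventually (\<lambda>x::real. 0 < (x+2) * (x+2 - k) / (x+2 + k * (b - 3/2)) - (x+2) * (x+1) * ln (1 + 1 / (x + k * b))) at_top"
    by (rule order_tendstoD) (use assms in simp)
  from eventually_compose_filterlim[OF this filterlim_real_sequentially]
  show ?thesis by eventually_elim (simp add: add_ac)
qed


text \<open>The integral of the convex function \<open>1 / t\<close> from \<open>y\<close> to
  \<open>y + 1\<close> is at least its midpoint value.\<close>

lemma ln_one_plus_inverse_ge:
  fixes y :: real
  assumes "0 < y"
  shows "1 / (y + 1 / 2) \<le> ln (1 + 1 / y)"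
proof -
  have "2 * (y + 1 - y) / (y + (y + 1)) \<le> ln (y + 1) - ln y"
    using assms by (intro ln_inverse_approx_ge) auto
  also have "\<dots> = ln ((y + 1) / y)"
    using assms by (simp add: ln_div)
  finally show ?thesis
    using assms by (simp add: field_simps)
qed

lemma sum_falling_square_ln_ge:
  fixes z :: "'a \<Rightarrow> nat" and b :: real
  assumes "finite I" "I \<noteq> {}" "3 / 2 < b" and M: "(\<Sum>i\<in>I. z i) = M"
  shows "real M * (real M - real (card I)) / (real M + real (card I) * (b - 3 / 2))
    \<le> (\<Sum>i\<in>I. real (z i) * (real (z i) - 1) * ln (1 + 1 / (real (z i) - 2 + b)))"
proof -
  define c k where "c = b - 3 / 2" and "k = real (card I)"
  define t where "t = real M / k + c"
  have c: "0 < c" using assms by (simp add: c_def)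
  have k: "0 < k" using assms by (simp add: k_def card_gt_0_iff)
  have t: "0 < t" using c k by (simp add: t_def add_nonneg_pos)
  \<comment> \<open>The tangent line to \<open>x * (x - 1) / (x + c)\<close> at the mean value \<open>M / k\<close>.\<close>
  have le: "real x - (1 + c) + c * (1 + c) * (2 / t - (real x + c) / t\<^sup>2)
      \<le> real x * (real x - 1) * ln (1 + 1 / (real x - 2 + b))" for x :: nat
  proof -
    have u: "0 < real x + c" using c by (simp add: add_nonneg_pos)
    \<comment> \<open>The square is the gap between \<open>1 / u\<close> and its tangent at
      \<open>t\<close>, for \<open>u = real x + c\<close>.\<close>
    have "0 \<le> (t - (real x + c))\<^sup>2 / (t\<^sup>2 * (real x + c))"
      using u by simp
    also have "\<dots> = 1 / (real x + c) - (2 / t - (real x + c) / t\<^sup>2)"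
      using u t by (simp add: divide_simps) (simp add: algebra_simps power2_eq_square)
    finally have "c * (1 + c) * (2 / t - (real x + c) / t\<^sup>2) \<le> c * (1 + c) * (1 / (real x + c))"
      using c by (intro mult_left_mono) auto
    \<comment> \<open>Polynomial division isolates the convex part
      \<open>c * (1 + c) / (x + c)\<close>.\<close>
    moreover have "real x - (1 + c) + c * (1 + c) * (1 / (real x + c))
        = real x * (real x - 1) * (1 / (real x + c))"
      using u by (simp add: divide_simps) (simp add: algebra_simps)
    moreover have "real x * (real x - 1) * (1 / (real x + c))
        \<le> real x * (real x - 1) * ln (1 + 1 / (real x - 2 + b))"
    \<comment> \<open>For \<open>x = 0\<close> the denominator \<open>x - 2 + b\<close> may fail to
      be positive, but the factor \<open>x * (x - 1)\<close> vanishes at 0 and 1.\<close>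
    proof (cases "x \<le> 1")
      case True
      then have "x = 0 \<or> x = 1" by auto
      then show ?thesis by auto
    next
      case False
      then have "0 < real x - 2 + b" and xc: "real x - 2 + b + 1 / 2 = real x + c"
        using assms(3) by (auto simp: c_def)
      then show ?thesis
        using False ln_one_plus_inverse_ge[of "real x - 2 + b", unfolded xc]
        by (intro mult_left_mono mult_nonneg_nonneg) auto
    qed
    ultimately show ?thesis by linarith
  qed
  have s: "(\<Sum>i\<in>I. real (z i)) = k * (t - c)"
    using k M by (simp add: t_def flip: of_nat_sum)
  have Mt: "real M = k * (t - c)" using k by (simp add: t_def)
  \<comment> \<open>The tangent line is affine in the count, so its sum depends only on the total
    and equals the value at equal counts.\<close>
  have "real M * (real M - k) / (real M + k * c)
      = k * (t - c) - k * (1 + c) + c * (1 + c) * (k * (2 / t) - (k * (t - c) + k * c) / t\<^sup>2)"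
    unfolding Mt using k t by (simp add: divide_simps) (simp add: algebra_simps power2_eq_square)
  also have "\<dots> = (\<Sum>i\<in>I. real (z i) - (1 + c) + c * (1 + c) * (2 / t - (real (z i) + c) / t\<^sup>2))"
    by (simp only: sum.distrib sum_subtractf s sum_distrib_left[symmetric]
        sum_divide_distrib[symmetric] sum_constant k_def[symmetric] distrib_left times_divide_eq_right)
  also have "\<dots> \<le> (\<Sum>i\<in>I. real (z i) * (real (z i) - 1) * ln (1 + 1 / (real (z i) - 2 + b)))"
    by (intro sum_mono le)
  finally show ?thesis by (simp add: c_def k_def)
qed

section \<open>The gain from one additional observation\<close>

lemma funpow_draw_falling_square:
  assumes "finite A" "a \<in> A"
  shows "(draw A p ^^ Suc (Suc n)) (\<lambda>z. real (z a) * (real (z a) - 1) * f (z a)) (\<lambda>_. 0)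
    = real (Suc (Suc n)) * real (Suc n) * (p a)\<^sup>2 * (draw A p ^^ n) (\<lambda>z. f (z a + 2)) (\<lambda>_. 0)"
proof -
  let ?e = "\<lambda>k. (\<lambda>_. 0)(a := k :: nat)"
  have "(draw A p ^^ Suc (Suc n)) (\<lambda>z. real (z a) * (real (z a) - 1) * f (z a)) (\<lambda>_. 0)
      = real (Suc (Suc n)) * p a * (draw A p ^^ Suc n) (\<lambda>z. (real (z a) - 1) * f (z a)) (?e 1)"
    using funpow_draw_size_bias[OF assms, where p=p and n="Suc n"
      and h="\<lambda>z. (real (z a) - 1) * f (z a)" and x="\<lambda>_. 0"]
    by (simp add: mult.assoc del: funpow.simps)
  \<comment> \<open>From a start with count 1 at \<open>a\<close>, the start term of the second size
    biasing cancels against the \<open>-1\<close>.\<close>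
  also have "(draw A p ^^ Suc n) (\<lambda>z. (real (z a) - 1) * f (z a)) (?e 1)
      = (draw A p ^^ Suc n) (\<lambda>z. -1 * f (z a) + real (z a) * f (z a)) (?e 1)"
    by (simp add: algebra_simps del: funpow.simps)
  also have "\<dots> = real (Suc n) * p a * (draw A p ^^ n) (\<lambda>z. f (z a)) (?e 2)"
    unfolding funpow_draw_linear funpow_draw_size_bias[OF assms]
    by (simp add: numeral_2_eq_2 del: funpow.simps)
  also have "(draw A p ^^ n) (\<lambda>z. f (z a)) (?e 2) = (draw A p ^^ n) (\<lambda>z. f (?e 2 a + z a)) (\<lambda>_. 0)"
    by (subst funpow_draw_translate[where h = "\<lambda>z. f (z a)" and w = "?e 2"]) (simp only: add_0_right)
  also have "?e 2 a = 2" by simp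
  finally show ?thesis by (simp add: power2_eq_square add.commute del: funpow.simps)
qed

text \<open>Up to the entropy term of \<open>q\<close>, the iterate of \<open>H n\<close> is minus
  the entropy risk of the estimator \<open>(z i + b) / (n + card I * b)\<close> from
  \<open>n\<close> observations, so its increase is a drop in risk.\<close>

lemma funpow_draw_ln_step:
  fixes q :: "'a \<Rightarrow> real" and b :: real
  assumes "finite I" "\<And>i. i \<in> I \<Longrightarrow> 0 \<le> q i" "(\<Sum>i\<in>I. q i) = 1" "3 / 2 < b"
    and gap: "real (n+2) * real (n+1) * ln (1 + 1 / (real n + card I * b))
     < real (n+2) * (real (n+2) - card I) / (real (n+2) + card I * (b - 3/2))"
  defines "H \<equiv> \<lambda>n z. \<Sum>i\<in>I. q i * ln ((real (z i) + b) / (real n + card I * b))"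
  shows "(draw I q ^^ n) (H n) (\<lambda>_. 0) < (draw I q ^^ Suc n) (H (Suc n)) (\<lambda>_. 0)"
proof -
  define C where "C = ln (1 + 1 / (real n + card I * b))"
  let ?L = "\<lambda>x. ln (1 + 1 / (real x - 2 + b))"
  have I: "I \<noteq> {}" using assms(3) by auto
  then have cb: "0 < card I * b" using assms(1,4) by (simp add: card_gt_0_iff)
  \<comment> \<open>The larger denominator costs \<open>C\<close> in total, as the weights sum to 1.
    A draw in \<open>i\<close> changes only the numerator of term \<open>i\<close>, whose weight
    \<open>q i\<close> meets the draw probability \<open>q i\<close>.\<close>
  have diff: "draw I q (H (Suc n)) z = 1 * H n z + ((\<Sum>i\<in>I. (q i)\<^sup>2 * ?L (z i + 2)) - C)" for z
  proof -
    have l: "ln ((real x + b) / (real (Suc n) + card I * b))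
        = ln ((real x + b) / (real n + card I * b)) - C" for x
    proof -
      have "1 + 1 / (real n + card I * b) = (real (Suc n) + card I * b) / (real n + card I * b)"
        using cb by (simp add: divide_simps)
      then show ?thesis using cb assms(4) by (simp add: C_def ln_div)
    qed
    have s: "ln ((real (Suc x) + b) / (real n + card I * b))
        = ln ((real x + b) / (real n + card I * b)) + ?L (x + 2)" for x
    proof -
      have "1 + 1 / (real (x + 2) - 2 + b) = (real (Suc x) + b) / (real x + b)"
        using assms(4) by (simp add: divide_simps)
      then show ?thesis using cb assms(4) by (simp add: ln_div)
    qed
    have "H (Suc n) (z(i := Suc (z i))) = H n z - C + q i * ?L (z i + 2)" if "i \<in> I" for i
    proof -
      have "H (Suc n) (z(i := Suc (z i)))
          = (\<Sum>j\<in>I. q j * ln ((real (z j) + b) / (real n + card I * b)) - q j * C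
              + (if j = i then q i * ?L (z i + 2) else 0))"
        unfolding H_def l by (intro sum.cong refl) (simp add: s distrib_left right_diff_distrib del: of_nat_Suc)
      then show ?thesis
        using assms(1,3) that
        by (simp add: H_def sum.distrib sum_subtractf flip: sum_distrib_right)
    qed
    then have "draw I q (H (Suc n)) z
        = (\<Sum>i\<in>I. q i * (H n z - C) + (q i)\<^sup>2 * ?L (z i + 2))"
      unfolding draw_def by (intro sum.cong refl) (simp add: distrib_left power2_eq_square mult.assoc del: fun_upd_apply)
    also have "\<dots> = H n z - C + (\<Sum>i\<in>I. (q i)\<^sup>2 * ?L (z i + 2))"
      by (simp add: sum.distrib assms(3) flip: sum_distrib_right)
    finally show ?thesis by simp
  qed
  let ?S = "\<Sum>i\<in>I. (q i)\<^sup>2 * (draw I q ^^ n) (\<lambda>z. ?L (z i + 2)) (\<lambda>_. 0)"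
  \<comment> \<open>This is \<open>C < ?S\<close> scaled to \<open>n + 2\<close> trials, where the
    integrand is free of \<open>q\<close> and can be bounded pointwise.\<close>
  have "real (n+2) * real (n+1) * C
      < (draw I q ^^ Suc (Suc n)) (\<lambda>z. \<Sum>i\<in>I. 1 * (real (z i) * (real (z i) - 1) * ?L (z i))) (\<lambda>_. 0)"
  proof (rule funpow_draw_greater[OF assms(1-3)])
    fix z :: "'a \<Rightarrow> nat"
    assume z: "(\<Sum>i\<in>I. z i) = (\<Sum>i\<in>I. 0) + Suc (Suc n)"
    then have "(\<Sum>i\<in>I. z i) = n + 2" by simp
    from sum_falling_square_ln_ge[OF assms(1) I assms(4) this] gap
    show "real (n+2) * real (n+1) * C < (\<Sum>i\<in>I. 1 * (real (z i) * (real (z i) - 1) * ?L (z i)))"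
      unfolding C_def mult_1 by linarith
  qed
  also have "\<dots> = real (n+2) * real (n+1) * ?S"
    unfolding funpow_draw_sum[OF assms(1)] sum_distrib_left
  proof (intro sum.cong refl)
    fix i assume "i \<in> I"
    from funpow_draw_falling_square[OF assms(1) this, where p=q and n=n and f="?L"]
    show "1 * (draw I q ^^ Suc (Suc n)) (\<lambda>z. real (z i) * (real (z i) - 1) * ?L (z i)) (\<lambda>_. 0)
      = real (n+2) * real (n+1) * ((q i)\<^sup>2 * (draw I q ^^ n) (\<lambda>z. ?L (z i + 2)) (\<lambda>_. 0))"
      by (simp only: mult_1 mult.assoc add_2_eq_Suc' Suc_eq_plus1[symmetric])
  qed
  finally have "C < ?S" by (rule mult_left_less_imp_less) simp
  moreover have "(draw I q ^^ Suc n) (H (Suc n)) (\<lambda>_. 0)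
      = (draw I q ^^ n) (H n) (\<lambda>_. 0) + (?S - C)"
  proof -
    have "(draw I q ^^ n) (\<lambda>z. (\<Sum>i\<in>I. (q i)\<^sup>2 * ?L (z i + 2)) - C) (\<lambda>_. 0) = ?S - C"
      using funpow_draw_linear[where A=I and p=q and n=n and c=1 and h="\<lambda>_. -C" and x="\<lambda>_. 0"
          and g="\<lambda>z. \<Sum>i\<in>I. (q i)\<^sup>2 * ?L (z i + 2)"]
      by (simp add: funpow_draw_sum[OF assms(1)] funpow_draw_const[OF assms(3)])
    moreover have "draw I q (H (Suc n)) = (\<lambda>z. 1 * H n z + ((\<Sum>i\<in>I. (q i)\<^sup>2 * ?L (z i + 2)) - C))"
      using diff by blast
    ultimately show ?thesis
      by (simp only: funpow_Suc_right comp_def funpow_draw_linear)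
  qed
  ultimately show ?thesis by simp
qed

section \<open>Multinomial expectations as iterated draws\<close>

text \<open>Given the counts \<open>x\<close> of \<open>Suc N\<close> trials, a single trial fell in
  cell \<open>a\<close> with weight \<open>x a / Suc N\<close>. Splitting by that cell and removing
  the trial leaves \<open>N\<close> trials.\<close>

lemma sum_multinomial_mass:
  assumes "finite A"
  shows "(\<Sum>x\<in>count_vectors A N. G x * multinomial_mass A N p x) = (draw A p ^^ N) G (\<lambda>_. 0)"
proof (induction N arbitrary: G)
  case 0
  have "count_vectors A 0 = {\<lambda>_. 0}"
    using assms by (auto simp: count_vectors_def fun_eq_iff)
  then show ?case by (simp add: multinomial_mass_def)
next
  case (Suc N)
  have bij: "bij_betw (\<lambda>y. y(a := Suc (y a))) (count_vectors A N) {x \<in> count_vectors A (Suc N). x a \<noteq> 0}"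
    if "a \<in> A" for a
    using assms that
    by (intro bij_betwI[where g = "\<lambda>x. x(a := x a - 1)"])
      (auto simp: count_vectors_def sum.remove[of A a])
  \<comment> \<open>The weight cancels the ratio of the two multinomial coefficients.\<close>
  have mass: "real (Suc (y a)) / real (Suc N) * multinomial_mass A (Suc N) p (y(a := Suc (y a)))
      = p a * multinomial_mass A N p y" if a: "a \<in> A" and y: "y \<in> count_vectors A N" for a y
  proof -
    have "y(a := Suc (y a)) \<in> count_vectors A (Suc N)"
      using bij_betwE[OF bij[OF a]] y by blast
    moreover have "(\<Prod>b\<in>A. fact ((y(a := Suc (y a))) b) :: real) = real (Suc (y a)) * (\<Prod>b\<in>A. fact (y b))"
      "(\<Prod>b\<in>A. p b ^ ((y(a := Suc (y a))) b)) = p a * (\<Prod>b\<in>A. p b ^ y b)"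
      using assms a by (simp_all add: prod.remove[of A a])
    ultimately show ?thesis
      using y by (simp add: multinomial_mass_def del: fun_upd_apply of_nat_Suc)
  qed
  have "(\<Sum>x\<in>count_vectors A (Suc N). G x * multinomial_mass A (Suc N) p x)
      = (\<Sum>x\<in>count_vectors A (Suc N). \<Sum>a\<in>A. real (x a) / real (Suc N) * (G x * multinomial_mass A (Suc N) p x))"
  proof (intro sum.cong refl)
    fix x assume "x \<in> count_vectors A (Suc N)"
    then have "(\<Sum>a\<in>A. real (x a) / real (Suc N)) = 1"
      by (simp add: count_vectors_def del: of_nat_Suc flip: sum_divide_distrib of_nat_sum)
    then show "G x * multinomial_mass A (Suc N) p x
        = (\<Sum>a\<in>A. real (x a) / real (Suc N) * (G x * multinomial_mass A (Suc N) p x))"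
      by (simp only: sum_distrib_right[symmetric] mult_1)
  qed
  also have "\<dots> = (\<Sum>a\<in>A. \<Sum>x\<in>count_vectors A (Suc N). real (x a) / real (Suc N) * (G x * multinomial_mass A (Suc N) p x))"
    by (rule sum.swap)
  also have "\<dots> = (\<Sum>a\<in>A. \<Sum>y\<in>count_vectors A N. p a * (G (y(a := Suc (y a))) * multinomial_mass A N p y))"
  proof (rule sum.cong[OF refl])
    fix a assume a: "a \<in> A"
    have "(\<Sum>x\<in>count_vectors A (Suc N). real (x a) / real (Suc N) * (G x * multinomial_mass A (Suc N) p x))
        = (\<Sum>x\<in>{x \<in> count_vectors A (Suc N). x a \<noteq> 0}. real (x a) / real (Suc N) * (G x * multinomial_mass A (Suc N) p x))"
      using assms by (intro sum.mono_neutral_right) (auto intro: finite_count_vectors)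
    also have "\<dots> = (\<Sum>y\<in>count_vectors A N. G (y(a := Suc (y a))) *
        (real (Suc (y a)) / real (Suc N) * multinomial_mass A (Suc N) p (y(a := Suc (y a)))))"
      by (subst sum.reindex_bij_betw[OF bij[OF a], symmetric]) (simp add: mult_ac)
    also have "\<dots> = (\<Sum>y\<in>count_vectors A N. p a * (G (y(a := Suc (y a))) * multinomial_mass A N p y))"
      by (intro sum.cong refl) (simp only: mass[OF a] mult_ac)
    finally show "(\<Sum>x\<in>count_vectors A (Suc N). real (x a) / real (Suc N) * (G x * multinomial_mass A (Suc N) p x))
        = (\<Sum>y\<in>count_vectors A N. p a * (G (y(a := Suc (y a))) * multinomial_mass A N p y))" .
  qed
  also have "\<dots> = (\<Sum>y\<in>count_vectors A N. draw A p G y * multinomial_mass A N p y)"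
    by (subst sum.swap) (simp only: draw_def sum_distrib_right mult.assoc)
  also have "\<dots> = (draw A p ^^ N) (draw A p G) (\<lambda>_. 0)"
    by (rule Suc)
  finally show ?case by (simp only: funpow_Suc_right comp_def)
qed

lemma set_multinomial_pmf:
  assumes "finite A" "\<And>a. a \<in> A \<Longrightarrow> 0 \<le> p a" "(\<Sum>a\<in>A. p a) = 1"
  shows "set_pmf (multinomial_pmf A N p) \<subseteq> count_vectors A N"
  using assms by (auto simp: set_pmf_eq pmf_multinomial multinomial_mass_def split: if_splits)

lemma expectation_multinomial:
  fixes G :: "('a \<Rightarrow> nat) \<Rightarrow> real"
  assumes "finite A" "\<And>a. a \<in> A \<Longrightarrow> 0 \<le> p a" "(\<Sum>a\<in>A. p a) = 1"
  shows "measure_pmf.expectation (multinomial_pmf A N p) G = (draw A p ^^ N) G (\<lambda>_. 0)"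
  using set_multinomial_pmf[OF assms, of N]
  by (subst integral_measure_pmf_real[OF finite_count_vectors[OF assms(1)]])
    (auto simp: pmf_multinomial[OF assms] sum_multinomial_mass[OF assms(1)])

lemma expectation_pair_pmf_finite:
  fixes f :: "'a \<times> 'b \<Rightarrow> real"
  assumes "finite (set_pmf P)" "finite (set_pmf Q)"
  shows "measure_pmf.expectation (pair_pmf P Q) f
    = measure_pmf.expectation P (\<lambda>x. measure_pmf.expectation Q (\<lambda>y. f (x, y)))"
proof -
  have Q: "Q \<bind> (\<lambda>y. return_pmf (x, y)) = map_pmf (Pair x) Q" for x :: 'a
    by (simp add: map_pmf_def)
  show ?thesis
    unfolding pair_pmf_def Q using assms
    by (subst pmf_expectation_bind[of "set_pmf P"])
      (auto simp: integral_measure_pmf[of "set_pmf P"])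
qed

section \<open>Reduction of the risks to row totals\<close>

text \<open>Merging categories: a draw in any cell of row \<open>i\<close> raises only row total
  \<open>i\<close>, so the cell probabilities of a row add up.\<close>

lemma funpow_draw_row_totals:
  "(draw (cells m n) p ^^ N) (\<lambda>x. h (row_totals m n x)) x
    = (draw {0..m} (\<lambda>i. \<Sum>j=0..n. p (i, j)) ^^ N) h (row_totals m n x)"
proof (induction N arbitrary: x)
  case (Suc N)
  have u: "row_totals m n (x((i, j) := Suc (x (i, j)))) = (row_totals m n x)(i := Suc (row_totals m n x i))"
    if "i \<le> m" "j \<le> n" for i j
  proof
    fix k
    have "(\<Sum>l=0..n. (x((i, j) := Suc (x (i, j)))) (i, l)) = Suc (\<Sum>l=0..n. x (i, l))"
      using that by (simp add: sum.remove[of "{0..n}" j])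
    then show "row_totals m n (x((i, j) := Suc (x (i, j)))) k = ((row_totals m n x)(i := Suc (row_totals m n x i))) k"
      using that by (simp add: row_totals_def)
  qed
  have "(draw (cells m n) p ^^ Suc N) (\<lambda>x. h (row_totals m n x)) x
      = (\<Sum>(i, j)\<in>cells m n. p (i, j) * (draw {0..m} (\<lambda>i. \<Sum>j=0..n. p (i, j)) ^^ N) h
          (row_totals m n (x((i, j) := Suc (x (i, j))))))"
    by (simp add: draw_def[of _ _ "(draw (cells m n) p ^^ N) _"] Suc case_prod_unfold del: fun_upd_apply)
  also have "\<dots> = (\<Sum>(i, j)\<in>cells m n. p (i, j) * (draw {0..m} (\<lambda>i. \<Sum>j=0..n. p (i, j)) ^^ N) h
          ((row_totals m n x)(i := Suc (row_totals m n x i))))"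
    by (intro sum.cong refl) (auto simp: cells_def u simp del: fun_upd_apply)
  finally show ?case
    by (simp add: cells_def draw_def[of _ _ "(draw {0..m} _ ^^ N) _"] sum_distrib_right
        flip: sum.cartesian_product del: fun_upd_apply)
qed simp


text \<open>Both estimators split a row total by the same factor
  \<open>(X (i, j) + 1/2) / (row total + b)\<close>, which cancels in the difference of
  logarithms.\<close>

lemma entropy_loss_diff:
  fixes X :: "nat \<times> nat \<Rightarrow> nat"
  assumes "p \<in> Theta m n"
  defines "a \<equiv> (1 + real m) * (1 + real n) / 2" and "b \<equiv> (1 + real n) / 2"
  shows "entropy_loss m n (p_tilde m n N X Y) p - entropy_loss m n (p_hat m n N N' X Y) p
    = (\<Sum>i=0..m. (\<Sum>j=0..n. p (i, j)) * ln ((real (row_totals m n X i + Y i) + b) / (real (N + N') + a)))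
      - (\<Sum>i=0..m. (\<Sum>j=0..n. p (i, j)) * ln ((real (row_totals m n X i) + b) / (real N + a)))"
proof -
  have a: "0 < a" and b: "0 < b" by (simp_all add: a_def b_def)
  have "p (i, j) * ln (p (i, j) / p_tilde m n N X Y (i, j)) - p (i, j) * ln (p (i, j) / p_hat m n N N' X Y (i, j))
      = p (i, j) * ln ((real (row_totals m n X i + Y i) + b) / (real (N + N') + a))
      - p (i, j) * ln ((real (row_totals m n X i) + b) / (real N + a))" if "i \<le> m" "j \<le> n" for i j
  proof -
    define r y x where "r = real (row_totals m n X i)" and "y = real (Y i)" and "x = real (X (i, j)) + 1 / 2"
    have pos: "0 < r + b" "0 < r + y + b" "0 < real N + a" "0 < real N + real N' + a" "0 < x" "0 < p (i, j)"
      using a b assms(1) that by (auto simp: r_def y_def x_def Theta_def add_nonneg_pos)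
    have "p_tilde m n N X Y (i, j) = x / (real N + a)"
      "p_hat m n N N' X Y (i, j) = (r + y + b) / (real N + real N' + a) * (x / (r + b))"
      by (simp_all add: p_tilde_def p_hat_def r_def y_def x_def a_def b_def)
    then have "ln (p (i, j) / p_tilde m n N X Y (i, j)) - ln (p (i, j) / p_hat m n N N' X Y (i, j))
       = ln ((r + y + b) / (real N + real N' + a)) - ln ((r + b) / (real N + a))"
      using pos by (simp add: ln_div ln_mult)
    then show ?thesis
      by (simp add: r_def y_def flip: right_diff_distrib)
  qed
  then show ?thesis
    unfolding entropy_loss_def sum_distrib_right sum_subtractf[symmetric]
    by (intro sum.cong refl) auto
qed

lemma risk_diff:
  assumes p: "p \<in> Theta m n"
  defines "q \<equiv> \<lambda>i. \<Sum>j=0..n. p (i, j)"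
  defines "H \<equiv> \<lambda>N z. \<Sum>i=0..m. q i * ln ((real (z i) + (1 + real n) / 2) / (real N + (1 + real m) * (1 + real n) / 2))"
  shows "risk m n N N' (p_tilde m n N) p - risk m n N N' (p_hat m n N N') p
    = (draw {0..m} q ^^ (N + N')) (H (N + N')) (\<lambda>_. 0) - (draw {0..m} q ^^ N) (H N) (\<lambda>_. 0)"
proof -
  let ?A = "cells m n" and ?T = "draw {0..m} q" and ?r = "row_totals m n"
  have A: "finite ?A" "\<And>a. a \<in> ?A \<Longrightarrow> 0 \<le> p a" "(\<Sum>a\<in>?A. p a) = 1"
    using p by (auto simp: cells_def Theta_def sum.cartesian_product less_imp_le)
  have q: "(\<Sum>i=0..m. q i) = 1"
    using p by (simp add: q_def Theta_def)
  have fin: "finite (set_pmf (multinomial_pmf ?A M p))" for M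
    using set_multinomial_pmf[OF A] finite_count_vectors[OF A(1)] by (rule finite_subset)
  have r0: "?r (\<lambda>_. 0) = (\<lambda>_. 0)"
    by (simp add: row_totals_def fun_eq_iff)
  have expect: "measure_pmf.expectation (multinomial_pmf ?A M p) (\<lambda>x. h (?r x)) = (?T ^^ M) h (\<lambda>_. 0)" for M h
    by (simp add: expectation_multinomial[OF A] funpow_draw_row_totals r0 q_def)
  have diff: "(?T ^^ M) (\<lambda>z. g z - h z) x = (?T ^^ M) g x - (?T ^^ M) h x" for M g h x
    using funpow_draw_linear[of M "{0..m}" q "-1" h g x] by (simp add: algebra_simps)
  let ?O = "observation_pmf m n N N' p"
  have int: "integrable ?O f" for f :: "_ \<Rightarrow> real"
    by (intro integrable_measure_pmf_finite) (simp add: observation_pmf_def fin)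
  have "risk m n N N' (p_tilde m n N) p - risk m n N N' (p_hat m n N N') p
      = measure_pmf.expectation ?O (\<lambda>(X, Y). H (N + N') (\<lambda>i. ?r X i + Y i) - H N (?r X))"
    unfolding risk_def Bochner_Integration.integral_diff[OF int int, symmetric]
    by (simp add: case_prod_unfold entropy_loss_diff[OF p] H_def q_def)
  also have "\<dots> = measure_pmf.expectation (multinomial_pmf ?A N p)
      (\<lambda>X. measure_pmf.expectation (multinomial_pmf ?A N' p)
        (\<lambda>y. H (N + N') (\<lambda>i. ?r X i + ?r y i) - H N (?r X)))"
    unfolding observation_pmf_def by (subst expectation_pair_pmf_finite) (simp_all add: fin)
  \<comment> \<open>The second sample becomes \<open>N'\<close> draws started at the row totals of
    the first; averaging over the first then composes to \<open>N + N'\<close> draws from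
    zero.\<close>
  also have "\<dots> = measure_pmf.expectation (multinomial_pmf ?A N p)
      (\<lambda>X. (?T ^^ N') (H (N + N')) (?r X) - H N (?r X))"
    by (simp add: expect[where h = "\<lambda>z. H (N + N') (\<lambda>i. ?r _ i + z i) - H N (?r _)"]
        diff funpow_draw_const[OF q] funpow_draw_translate[where h = "H (N + N')"])
  also have "\<dots> = (?T ^^ (N + N')) (H (N + N')) (\<lambda>_. 0) - (?T ^^ N) (H N) (\<lambda>_. 0)"
    by (simp add: expect[where h = "\<lambda>z. (?T ^^ N') (H (N + N')) z - H N z"] diff funpow_add)
  finally show ?thesis .
qed

theorem theorem2p2:
  fixes m n N' :: nat
  assumes "1 \<le> m" and "3 \<le> n" and "1 \<le> N'"
  shows "\<exists>N\<^sub>0::nat. \<forall>N::nat. N \<ge> 1 \<and> N \<ge> N\<^sub>0 \<longrightarrow>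
           dominated_by m n N N' (p_tilde m n N) (p_hat m n N N')"
proof -
  define b where "b = (1 + real n) / 2"
  have b: "3 / 2 < b" and k: "1 < real (Suc m)"
    using assms by (simp_all add: b_def)
  \<comment> \<open>The threshold does not involve \<open>p\<close>, so it is uniform over the
    parameter space.\<close>
  obtain N0 where gap: "\<And>N. N0 \<le> N \<Longrightarrow> real (N+2) * real (N+1) * ln (1 + 1 / (real N + real (Suc m) * b))
     < real (N+2) * (real (N+2) - real (Suc m)) / (real (N+2) + real (Suc m) * (b - 3/2))"
    using eventually_ln_less_balanced[OF k, of b] unfolding eventually_sequentially by blast
  have less: "risk m n N N' (p_hat m n N N') p < risk m n N N' (p_tilde m n N) p"
    if N: "N0 \<le> N" and p: "p \<in> Theta m n" for N p
  proof -
    define q where "q i = (\<Sum>j=0..n. p (i, j))" for i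
    define s where "s M = (draw {0..m} q ^^ M)
      (\<lambda>z. \<Sum>i=0..m. q i * ln ((real (z i) + b) / (real M + card {0..m} * b))) (\<lambda>_. 0)" for M
    have q: "\<And>i. i \<in> {0..m} \<Longrightarrow> 0 \<le> q i" "(\<Sum>i\<in>{0..m}. q i) = 1"
      using p by (auto simp: q_def Theta_def less_imp_le intro!: sum_nonneg)
    have "s M < s (Suc M)" if "N0 \<le> M" for M
      unfolding s_def
      by (rule funpow_draw_ln_step[OF _ q b]) (use gap[OF that] in simp_all)
    \<comment> \<open>The one-step gain holds at every sample size from \<open>N0\<close> on, hence
      at each of the \<open>N'\<close> steps after \<open>N\<close>.\<close>
    then have "strict_mono (\<lambda>d. s (N + d))"
      using N by (intro strict_mono_Suc_iff[THEN iffD2]) simp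
    then have "s N < s (N + N')"
      using strict_monoD[of "\<lambda>d. s (N + d)" 0 N'] assms(3) by simp
    moreover have "risk m n N N' (p_tilde m n N) p - risk m n N N' (p_hat m n N N') p = s (N + N') - s N"
      using risk_diff[OF p, of N N'] by (simp add: s_def q_def[abs_def] b_def)
    ultimately show ?thesis by linarith
  qed
  \<comment> \<open>The inequality is strict at every parameter; the uniform distribution shows that
    there is one.\<close>
  have "(\<lambda>_. 1 / ((1 + real m) * (1 + real n))) \<in> Theta m n"
    by (simp add: Theta_def)
  with less show ?thesis
    unfolding dominated_by_def by (meson less_imp_le)
qed

end
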